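(* If $K$ is an infinite field, then the Heisenberg group $H(K)$, as a structure in the language of groups, does not have quantifier elimination.
   Context: For a field $K$, the Heisenberg group $H(K)=\mathrm{UT}_3(K)$ is the group, under matrix multiplication, of upper unitriangular $3\times 3$ matrices with coefficients in $K$. A structure has quantifier elimination if its complete theory does, i.e. every formula is equivalent, modulo the theory, to a quantifier-free formula in the same language (here the pure language of groups, without extra constants). *)

theory Defs
  imports "HOL-Algebra.Group" "Jordan_Normal_Form.Matrix"
begin

subsection \<open>First-order logic in the language of groups\<close>

datatype gterm =
    GVar nat
  | GOne
  | GMult gterm gterm
  | GInv gterm

datatype gformula =
    GEq gterm gterm
  | GNeg gformula
  | GConj gformula gformula
  | GDisj gformula gformula
  | GImp gformula gformula
  | GAll nat gformula
  | GEx nat gformula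

fun tvars :: "gterm \<Rightarrow> nat set" where
  "tvars (GVar x) = {x}"
| "tvars GOne = {}"
| "tvars (GMult t u) = tvars t \<union> tvars u"
| "tvars (GInv t) = tvars t"

fun free_vars :: "gformula \<Rightarrow> nat set" where
  "free_vars (GEq t u) = tvars t \<union> tvars u"
| "free_vars (GNeg \<phi>) = free_vars \<phi>"
| "free_vars (GConj \<phi> \<psi>) = free_vars \<phi> \<union> free_vars \<psi>"
| "free_vars (GDisj \<phi> \<psi>) = free_vars \<phi> \<union> free_vars \<psi>"
| "free_vars (GImp \<phi> \<psi>) = free_vars \<phi> \<union> free_vars \<psi>"
| "free_vars (GAll x \<phi>) = free_vars \<phi> - {x}"
| "free_vars (GEx x \<phi>) = free_vars \<phi> - {x}"

definition sentence :: "gformula \<Rightarrow> bool" where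
  "sentence \<phi> \<longleftrightarrow> free_vars \<phi> = {}"

fun quantifier_free :: "gformula \<Rightarrow> bool" where
  "quantifier_free (GEq t u) \<longleftrightarrow> True"
| "quantifier_free (GNeg \<phi>) \<longleftrightarrow> quantifier_free \<phi>"
| "quantifier_free (GConj \<phi> \<psi>) \<longleftrightarrow> quantifier_free \<phi> \<and> quantifier_free \<psi>"
| "quantifier_free (GDisj \<phi> \<psi>) \<longleftrightarrow> quantifier_free \<phi> \<and> quantifier_free \<psi>"
| "quantifier_free (GImp \<phi> \<psi>) \<longleftrightarrow> quantifier_free \<phi> \<and> quantifier_free \<psi>"
| "quantifier_free (GAll x \<phi>) \<longleftrightarrow> False"
| "quantifier_free (GEx x \<phi>) \<longleftrightarrow> False"

text \<open>Arbitrary structures for the signature of groups; no group axioms are imposed.\<close>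

record 'a gstructure =
  dom_of :: "'a set"
  one_of :: 'a
  mult_of :: "'a \<Rightarrow> 'a \<Rightarrow> 'a"
  inv_of :: "'a \<Rightarrow> 'a"

definition is_structure :: "'a gstructure \<Rightarrow> bool" where
  "is_structure M \<longleftrightarrow>
     one_of M \<in> dom_of M \<and>
     (\<forall>a\<in>dom_of M. \<forall>b\<in>dom_of M. mult_of M a b \<in> dom_of M) \<and>
     (\<forall>a\<in>dom_of M. inv_of M a \<in> dom_of M)"

fun tval :: "'a gstructure \<Rightarrow> (nat \<Rightarrow> 'a) \<Rightarrow> gterm \<Rightarrow> 'a" where
  "tval M s (GVar x) = s x"
| "tval M s GOne = one_of M"
| "tval M s (GMult t u) = mult_of M (tval M s t) (tval M s u)"
| "tval M s (GInv t) = inv_of M (tval M s t)"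

fun sat :: "'a gstructure \<Rightarrow> (nat \<Rightarrow> 'a) \<Rightarrow> gformula \<Rightarrow> bool" where
  "sat M s (GEq t u) \<longleftrightarrow> tval M s t = tval M s u"
| "sat M s (GNeg \<phi>) \<longleftrightarrow> \<not> sat M s \<phi>"
| "sat M s (GConj \<phi> \<psi>) \<longleftrightarrow> sat M s \<phi> \<and> sat M s \<psi>"
| "sat M s (GDisj \<phi> \<psi>) \<longleftrightarrow> sat M s \<phi> \<or> sat M s \<psi>"
| "sat M s (GImp \<phi> \<psi>) \<longleftrightarrow> (sat M s \<phi> \<longrightarrow> sat M s \<psi>)"
| "sat M s (GAll x \<phi>) \<longleftrightarrow> (\<forall>a\<in>dom_of M. sat M (s(x := a)) \<phi>)"
| "sat M s (GEx x \<phi>) \<longleftrightarrow> (\<exists>a\<in>dom_of M. sat M (s(x := a)) \<phi>)"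

definition assignments :: "'a gstructure \<Rightarrow> (nat \<Rightarrow> 'a) set" where
  "assignments M = {s. \<forall>x. s x \<in> dom_of M}"

definition holds_in :: "'a gstructure \<Rightarrow> gformula \<Rightarrow> bool" where
  "holds_in M \<phi> \<longleftrightarrow> (\<forall>s\<in>assignments M. sat M s \<phi>)"

definition complete_theory :: "'a gstructure \<Rightarrow> gformula set" where
  "complete_theory M = {\<phi>. sentence \<phi> \<and> holds_in M \<phi>}"

definition is_model :: "'a gstructure \<Rightarrow> gformula set \<Rightarrow> bool" where
  "is_model N T \<longleftrightarrow> is_structure N \<and> (\<forall>\<phi>\<in>T. holds_in N \<phi>)"

text \<open>
  HOL cannot quantify over models of every type at once, so equivalence modulo \<open>T\<close> ranges over
  the models of \<open>T\<close> carried by subsets of a given type. It is only used below for \<open>T\<close> the complete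
  theory of a structure \<open>M\<close> and the type of the elements of \<open>M\<close>, where the restriction is harmless:
  by \<open>equivalent_modulo_complete_theory\<close>, equivalence then holds in the models of \<open>T\<close> of any type.
\<close>

definition equivalent_modulo :: "'a itself \<Rightarrow> gformula set \<Rightarrow> gformula \<Rightarrow> gformula \<Rightarrow> bool" where
  "equivalent_modulo _ T \<phi> \<psi> \<longleftrightarrow>
     (\<forall>N :: 'a gstructure. is_model N T \<longrightarrow> (\<forall>s\<in>assignments N. sat N s \<phi> \<longleftrightarrow> sat N s \<psi>))"

lemma finite_tvars: "finite (tvars t)"
  by (induction t) auto

lemma finite_free_vars: "finite (free_vars \<phi>)"
  by (induction \<phi>) (auto simp: finite_tvars)

lemma free_vars_closure: "free_vars (foldr GAll xs \<phi>) = free_vars \<phi> - set xs"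
  by (induction xs) auto

lemma holds_in_closure: "holds_in M (foldr GAll xs \<phi>) \<longleftrightarrow> holds_in M \<phi>"
proof (induction xs)
  case (Cons x xs)
  have "holds_in M (GAll x \<chi>) \<longleftrightarrow> holds_in M \<chi>" for \<chi>
  proof
    assume l: "holds_in M (GAll x \<chi>)"
    show "holds_in M \<chi>"
      unfolding holds_in_def
    proof
      fix s assume s: "s \<in> assignments M"
      with l have "sat M (s(x := s x)) \<chi>"
        unfolding holds_in_def assignments_def sat.simps by blast
      then show "sat M s \<chi>" by simp
    qed
  next
    assume r: "holds_in M \<chi>"
    then show "holds_in M (GAll x \<chi>)"
      by (auto simp: holds_in_def assignments_def)
  qed
  with Cons show ?case by simp
qed simp

lemma equivalent_modulo_complete_theory:
  fixes M :: "'a gstructure"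
  assumes "is_structure M"
    and "equivalent_modulo TYPE('a) (complete_theory M) \<phi> \<psi>"
  shows "equivalent_modulo TYPE('b) (complete_theory M) \<phi> \<psi>"
proof -
  define \<chi> where "\<chi> = GConj (GImp \<phi> \<psi>) (GImp \<psi> \<phi>)"
  obtain xs where xs: "set xs = free_vars \<chi>"
    using finite_list[OF finite_free_vars] by blast
  have "is_model M (complete_theory M)"
    using assms(1) by (simp add: is_model_def complete_theory_def)
  with assms(2) have "holds_in M \<chi>"
    by (auto simp: equivalent_modulo_def holds_in_def \<chi>_def)
  then have "foldr GAll xs \<chi> \<in> complete_theory M"
    by (simp add: complete_theory_def sentence_def free_vars_closure holds_in_closure xs)
  then have "holds_in N \<chi>" if "is_model N (complete_theory M)" for N :: "'b gstructure"
    using that holds_in_closure[of N xs \<chi>] by (auto simp: is_model_def)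
  then show ?thesis
    by (auto simp: equivalent_modulo_def holds_in_def \<chi>_def)
qed

definition theory_has_qe :: "'a itself \<Rightarrow> gformula set \<Rightarrow> bool" where
  "theory_has_qe U T \<longleftrightarrow> (\<forall>\<phi>. \<exists>\<psi>. quantifier_free \<psi> \<and> equivalent_modulo U T \<phi> \<psi>)"

definition has_quantifier_elimination :: "'a gstructure \<Rightarrow> bool" where
  "has_quantifier_elimination M \<longleftrightarrow> theory_has_qe TYPE('a) (complete_theory M)"

definition group_structure :: "('a, 'b) monoid_scheme \<Rightarrow> 'a gstructure" where
  "group_structure G =
     \<lparr>dom_of = carrier G, one_of = \<one>\<^bsub>G\<^esub>, mult_of = (\<otimes>\<^bsub>G\<^esub>), inv_of = m_inv G\<rparr>"

lemma is_structure_group_structure: "group G \<Longrightarrow> is_structure (group_structure G)"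
  by (simp add: is_structure_def group_structure_def group.is_monoid monoid.m_closed)


subsection \<open>The Heisenberg group\<close>

definition unitriangular :: "nat \<Rightarrow> 'k::field mat monoid" where
  "unitriangular n =
     \<lparr>carrier = {A \<in> carrier_mat n n. upper_triangular A \<and> (\<forall>i<n. A $$ (i, i) = 1)},
      mult = (*), one = 1\<^sub>m n\<rparr>"

abbreviation heisenberg_group :: "'k::field mat monoid" where
  "heisenberg_group \<equiv> unitriangular 3"

lemma heisenberg_carrier_iff:
  "A \<in> carrier heisenberg_group \<longleftrightarrow>
     dim_row A = 3 \<and> dim_col A = 3 \<and>
     A $$ (0, 0) = 1 \<and> A $$ (1, 1) = 1 \<and> A $$ (2, 2) = 1 \<and>
     A $$ (1, 0) = 0 \<and> A $$ (2, 0) = 0 \<and> A $$ (2, 1) = 0"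
  (is "_ \<longleftrightarrow> ?R")
proof
  assume A: "A \<in> carrier heisenberg_group"
  then have dim: "dim_row A = 3" "dim_col A = 3"
    by (auto simp: unitriangular_def)
  have diag: "A $$ (i, i) = 1" if "i < 3" for i
    using A that by (simp add: unitriangular_def)
  have low: "A $$ (i, j) = 0" if "i < 3" "j < i" for i j
    using A that dim by (simp add: unitriangular_def upper_triangular_def)
  show ?R
    by (intro conjI dim diag low) simp_all
next
  assume R: ?R
  have "A $$ (i, j) = 0" if "i < 3" "j < i" for i j
  proof -
    from that consider "i = 1" "j = 0" | "i = 2" "j = 0" | "i = 2" "j = 1" by linarith
    then show ?thesis by cases (use R in simp_all)
  qed
  moreover have "A $$ (i, i) = 1" if "i < 3" for i
  proof -
    from that consider "i = 0" | "i = 1" | "i = 2" by linarith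
    then show ?thesis by cases (use R in simp_all)
  qed
  moreover have "A \<in> carrier_mat 3 3"
    by (rule carrier_matI) (use R in blast)+
  ultimately show "A \<in> carrier heisenberg_group"
    by (simp add: unitriangular_def upper_triangular_def)
qed

lemma group_heisenberg_group: "group (heisenberg_group :: 'k::field mat monoid)"
proof (rule groupI)
  let ?H = "heisenberg_group :: 'k mat monoid"
  have mult: "A \<otimes>\<^bsub>?H\<^esub> B = A * B" and one: "\<one>\<^bsub>?H\<^esub> = 1\<^sub>m 3" for A B
    by (simp_all add: unitriangular_def)
  have mat: "A \<in> carrier_mat 3 3" if "A \<in> carrier ?H" for A
    using that by (simp add: unitriangular_def)
  have ran: "{0..<3} = {0, 1, 2 :: nat}" by auto
  show "\<one>\<^bsub>?H\<^esub> \<in> carrier ?H"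
    unfolding one heisenberg_carrier_iff by simp
  show "A \<otimes>\<^bsub>?H\<^esub> B \<in> carrier ?H" if "A \<in> carrier ?H" "B \<in> carrier ?H" for A B
    using that unfolding mult heisenberg_carrier_iff by (simp add: scalar_prod_def ran)
  show "A \<otimes>\<^bsub>?H\<^esub> B \<otimes>\<^bsub>?H\<^esub> C = A \<otimes>\<^bsub>?H\<^esub> (B \<otimes>\<^bsub>?H\<^esub> C)"
    if "A \<in> carrier ?H" "B \<in> carrier ?H" "C \<in> carrier ?H" for A B C
    unfolding mult by (rule assoc_mult_mat[OF mat mat mat]) (rule that)+
  show "\<one>\<^bsub>?H\<^esub> \<otimes>\<^bsub>?H\<^esub> A = A" if "A \<in> carrier ?H" for A
    unfolding mult one by (rule left_mult_one_mat[OF mat[OF that]])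
  show "\<exists>B\<in>carrier ?H. B \<otimes>\<^bsub>?H\<^esub> A = \<one>\<^bsub>?H\<^esub>" if "A \<in> carrier ?H" for A
  proof -
    define B :: "'k mat" where "B = mat 3 3 (\<lambda>(i, j).
      if i = j then 1
      else if i = 0 \<and> j = 1 then - A $$ (0, 1)
      else if i = 1 \<and> j = 2 then - A $$ (1, 2)
      else if i = 0 \<and> j = 2 then A $$ (0, 1) * A $$ (1, 2) - A $$ (0, 2)
      else 0)"
    have B: "B \<in> carrier ?H"
      unfolding heisenberg_carrier_iff by (simp add: B_def)
    have B': "B $$ (0, 1) = - A $$ (0, 1)" "B $$ (1, 2) = - A $$ (1, 2)"
      "B $$ (0, 2) = A $$ (0, 1) * A $$ (1, 2) - A $$ (0, 2)"
      by (simp_all add: B_def)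
    have "B * A = 1\<^sub>m 3"
    proof (rule eq_matI)
      fix i j assume "i < dim_row (1\<^sub>m 3 :: 'k mat)" "j < dim_col (1\<^sub>m 3 :: 'k mat)"
      then have "i < 3" "j < 3" by simp_all
      then have "i = 0 \<or> i = 1 \<or> i = 2" "j = 0 \<or> j = 1 \<or> j = 2" by linarith+
      then show "(B * A) $$ (i, j) = 1\<^sub>m 3 $$ (i, j)"
        using B that B' unfolding heisenberg_carrier_iff
        by (elim disjE) (simp_all add: scalar_prod_def ran)
    qed (use B that in \<open>simp_all add: heisenberg_carrier_iff\<close>)
    with B show ?thesis unfolding mult one by blast
  qed
qed

end

(* The additive group of K embeds into H(K) both by transvections in the position (0,1), which
   are not central, and by transvections in the position (0,2), which are central.  Quantifier-free
   formulas are preserved and reflected by embeddings, so they cannot tell the images of 1 under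
   the two embeddings apart, whereas the formula expressing that x is central does. *)
theory Submission
  imports Defs "Jordan_Normal_Form.Gauss_Jordan_Elimination"
begin

text \<open>The functions of a structure are total on the type, so every condition is relativised to
  \<open>dom_of N\<close>; off that set \<open>f\<close> is arbitrary.\<close>

definition is_embedding :: "'a gstructure \<Rightarrow> 'b gstructure \<Rightarrow> ('a \<Rightarrow> 'b) \<Rightarrow> bool" where
  "is_embedding N M f \<longleftrightarrow>
     inj_on f (dom_of N) \<and> f ` dom_of N \<subseteq> dom_of M \<and>
     f (one_of N) = one_of M \<and>
     (\<forall>a\<in>dom_of N. \<forall>b\<in>dom_of N. f (mult_of N a b) = mult_of M (f a) (f b)) \<and>
     (\<forall>a\<in>dom_of N. f (inv_of N a) = inv_of M (f a))"

text \<open>Lets the conditions of an embedding, imposed only on the domain, be applied to values of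
  terms.\<close>

lemma tval_closed:
  assumes "is_structure N" "s \<in> assignments N"
  shows "tval N s t \<in> dom_of N"
  using assms by (induction t) (auto simp: is_structure_def assignments_def)

lemma tval_embedding:
  assumes "is_structure N" "is_embedding N M f" "s \<in> assignments N"
  shows "tval M (f \<circ> s) t = f (tval N s t)"
proof (induction t)
  case (GVar x)
  then show ?case by simp
next
  case GOne
  then show ?case using assms(2) by (simp add: is_embedding_def)
next
  case (GMult t u)
  then show ?case
    using assms(2) tval_closed[OF assms(1,3)] by (simp add: is_embedding_def)
next
  case (GInv t)
  then show ?case
    using assms(2) tval_closed[OF assms(1,3)] by (simp add: is_embedding_def)
qed

text \<open>Injectivity of \<open>f\<close> reflects equations between values of terms, the
  connectives carry this over, and the quantifier cases are vacuous.\<close>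

lemma quantifier_free_sat_embedding:
  assumes "quantifier_free \<psi>" "is_structure N" "is_embedding N M f" "s \<in> assignments N"
  shows "sat M (f \<circ> s) \<psi> \<longleftrightarrow> sat N s \<psi>"
  using assms(1)
proof (induction \<psi>)
  case (GEq t u)
  have "inj_on f (dom_of N)"
    using assms(3) by (simp add: is_embedding_def)
  then show ?case
    using tval_closed[OF assms(2,4)]
    by (simp only: sat.simps tval_embedding[OF assms(2-4)] inj_on_eq_iff)
qed simp_all

text \<open>\<open>M\<close> is a model of its own theory, so in \<open>M\<close> the formula \<phi>
  agrees with a quantifier-free one, whose truth pulls back along both \<open>f\<close> and
  \<open>g\<close> to the same statement about \<open>s\<close> in \<open>N\<close>. No relation
  between the theories of \<open>N\<close> and \<open>M\<close> is assumed.\<close>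

lemma has_quantifier_elimination_embeddings:
  assumes "has_quantifier_elimination M" "is_structure M" "is_structure N"
    and f: "is_embedding N M f" and g: "is_embedding N M g"
    and s: "s \<in> assignments N"
  shows "sat M (f \<circ> s) \<phi> \<longleftrightarrow> sat M (g \<circ> s) \<phi>"
proof -
  have "is_model M (complete_theory M)"
    using assms(2) by (simp add: is_model_def complete_theory_def)
  with assms(1) obtain \<psi> where qf: "quantifier_free \<psi>"
    and eq: "\<And>s. s \<in> assignments M \<Longrightarrow> sat M s \<phi> \<longleftrightarrow> sat M s \<psi>"
    unfolding has_quantifier_elimination_def theory_has_qe_def equivalent_modulo_def by blast
  have "f \<circ> s \<in> assignments M" "g \<circ> s \<in> assignments M"
    using f g s by (auto simp: is_embedding_def assignments_def)
  then show ?thesis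
    using quantifier_free_sat_embedding[OF qf assms(3) f s]
      quantifier_free_sat_embedding[OF qf assms(3) g s] eq by simp
qed

definition additive_group :: "'k::ab_group_add gstructure" where
  "additive_group = \<lparr>dom_of = UNIV, one_of = 0, mult_of = (+), inv_of = uminus\<rparr>"

lemma is_structure_additive_group: "is_structure additive_group"
  by (simp add: is_structure_def additive_group_def)

text \<open>For distinct \<open>i\<close>, \<open>j\<close> below 3 this is I + a E, where E is the
  matrix unit with its 1 at (i, j).\<close>

abbreviation transvection :: "nat \<Rightarrow> nat \<Rightarrow> 'k::field \<Rightarrow> 'k mat" where
  "transvection i j a \<equiv> addrow_mat 3 a i j"

lemma transvection_carrier:
  assumes "i < j"
  shows "transvection i j a \<in> carrier heisenberg_group"
  using assms by (auto simp: heisenberg_carrier_iff)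

text \<open>The matrix unit E at (i, j) has square zero, so (I + a E)(I + b E) = I + (a + b)
  E.\<close>

lemma transvection_mult:
  assumes "i < j" "j < 3"
  shows "transvection i j a * transvection i j b = transvection i j (a + b)"
proof -
  have ran: "{0..<3} = {0, 1, 2 :: nat}" by auto
  consider "i = 0" "j = 1" | "i = 0" "j = 2" | "i = 1" "j = 2"
    using assms by linarith
  then show ?thesis
    by cases (rule eq_matI; auto simp: scalar_prod_def ran)+
qed

lemma transvection_zero: "transvection i j 0 = 1\<^sub>m 3"
  by (rule eq_matI) auto

lemma transvection_embedding:
  assumes "i < j" "j < 3"
  shows "is_embedding additive_group (group_structure heisenberg_group)
           (transvection i j :: 'k::field \<Rightarrow> 'k mat)"
proof -
  let ?H = "heisenberg_group :: 'k mat monoid"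
  have mult: "A \<otimes>\<^bsub>?H\<^esub> B = A * B" and one: "\<one>\<^bsub>?H\<^esub> = 1\<^sub>m 3" for A B
    by (simp_all add: unitriangular_def)
  have "inj (transvection i j :: 'k \<Rightarrow> 'k mat)"
  proof (rule injI)
    fix a b :: 'k
    assume "transvection i j a = transvection i j b"
    then have "transvection i j a $$ (i, j) = transvection i j b $$ (i, j)" by simp
    then show "a = b" using assms by simp
  qed
  \<comment> \<open>The inverse in the group is a definite description; it is identified by
    exhibiting a left inverse in the carrier.\<close>
  moreover have "inv\<^bsub>?H\<^esub> transvection i j a = transvection i j (- a)" for a
    by (rule group.inv_equality[OF group_heisenberg_group])
      (simp_all add: mult one transvection_mult assms transvection_zero transvection_carrier)
  ultimately show ?thesis
    by (auto simp: is_embedding_def additive_group_def group_structure_def mult one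
        transvection_zero transvection_mult transvection_carrier assms)
qed

text \<open>On the left the transvection adds \<open>a\<close> times row 2 of \<open>A\<close> to
  row 0, on the right \<open>a\<close> times column 0 to column 2. As row 2 is (0, 0, 1) and column
  0 is its counterpart (1, 0, 0), both only add \<open>a\<close> to the entry (0, 2).\<close>

lemma transvection_0_2_central:
  assumes "A \<in> carrier heisenberg_group"
  shows "transvection 0 2 a * A = A * transvection 0 2 a"
proof -
  have ran: "{0..<3} = {0, 1, 2 :: nat}" by auto
  show ?thesis
  proof (rule eq_matI)
    fix i j
    assume "i < dim_row (A * transvection 0 2 a)" "j < dim_col (A * transvection 0 2 a)"
    then have "i < 3" "j < 3"
      using assms unfolding heisenberg_carrier_iff by simp_all
    then have "i = 0 \<or> i = 1 \<or> i = 2" "j = 0 \<or> j = 1 \<or> j = 2" by linarith+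
    then show "(transvection 0 2 a * A) $$ (i, j) = (A * transvection 0 2 a) $$ (i, j)"
      using assms unfolding heisenberg_carrier_iff
      by (elim disjE) (simp_all add: scalar_prod_def ran)
  qed (use assms in \<open>simp_all add: heisenberg_carrier_iff\<close>)
qed

text \<open>The entry (0, 2) is 1 in the first product and 0 in the second.\<close>

lemma transvection_0_1_not_central:
  "transvection 0 1 1 * transvection 1 2 1 \<noteq> transvection 1 2 1 * transvection 0 1 (1 :: 'k::field)"
proof
  have ran: "{0..<3} = {0, 1, 2 :: nat}" by auto
  assume "transvection 0 1 1 * transvection 1 2 1 = transvection 1 2 1 * transvection 0 1 (1 :: 'k)"
  then have "(transvection 0 1 1 * transvection 1 2 1) $$ (0, 2) =
      (transvection 1 2 1 * transvection 0 1 (1 :: 'k)) $$ (0, 2)" by simp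
  then show False by (simp add: scalar_prod_def ran)
qed

theorem theorem4p1:
  assumes "infinite (UNIV :: 'k::field set)"
  shows "\<not> has_quantifier_elimination (group_structure (heisenberg_group :: 'k mat monoid))"
proof
  let ?M = "group_structure (heisenberg_group :: 'k mat monoid)"
  define \<phi> where
    "\<phi> = GAll 1 (GEq (GMult (GVar 0) (GVar 1)) (GMult (GVar 1) (GVar 0)))"
  have sat_\<phi>: "sat ?M s \<phi> \<longleftrightarrow> (\<forall>A\<in>carrier heisenberg_group. s 0 * A = A * s 0)" for s
    by (simp add: \<phi>_def group_structure_def unitriangular_def)
  \<comment> \<open>Variable 0 is the only free variable of \<phi>. Its value has to be nonzero,
    since both embeddings send 0 to the identity matrix, which is central.\<close>
  define s where "s = (\<lambda>_ :: nat. 1 :: 'k)"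
  assume "has_quantifier_elimination ?M"
  then have "sat ?M (transvection 0 1 \<circ> s) \<phi> \<longleftrightarrow> sat ?M (transvection 0 2 \<circ> s) \<phi>"
    by (rule has_quantifier_elimination_embeddings
        [OF _ is_structure_group_structure[OF group_heisenberg_group] is_structure_additive_group])
      ((rule transvection_embedding; simp)+, simp add: assignments_def additive_group_def)
  moreover have "sat ?M (transvection 0 2 \<circ> s) \<phi>"
    by (simp add: sat_\<phi> transvection_0_2_central)
  moreover have "\<not> sat ?M (transvection 0 1 \<circ> s) \<phi>"
    \<comment> \<open>The transvection at (1, 2) is the element of the carrier that refutes
      centrality.\<close>
    using transvection_0_1_not_central transvection_carrier[of 1 2 1]
    by (auto simp: sat_\<phi> s_def)
  ultimately show False by simp
qed

end
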